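(* Let $X$ be a nonempty second-countable compact Hausdorff space, let $S$ be a proper dyadic subbase of $X$, and let $D$ be either $D_S$ or $\widehat{D}_S$. Then $\widetilde{X}=\min(L(D))$, and $X$ (identified with $\widetilde{X}$ via the embedding $x\mapsto\tilde{x}$) is a retract of the topological space $L(D)$.
   Context: $\mathbb{T}=\{0,1,\bot\}$ is ordered by $\bot\sqsubseteq 0$, $\bot\sqsubseteq 1$, and $\mathbb{T}^\omega$ (infinite sequences over $\mathbb{T}$) carries the product order $\sqsubseteq$. For $p\in\mathbb{T}^\omega$, $\mathrm{dom}(p)=\{k: p(k)\neq\bot\}$; $\mathbb{T}^*$ is the set of $p\in\mathbb{T}^\omega$ with $\mathrm{dom}(p)$ finite. For $m\in\mathbb{N}$, $p|_m\in\mathbb{T}^*$ is defined by $p|_m(k)=p(k)$ if $k<m$ and $p|_m(k)=\bot$ if $k\ge m$. A dyadic subbase of $X$ is a family $S=\{S_{n,a}: n\in\mathbb{N}, a\in\{0,1\}\}$ of regular open sets (open sets equal to the interior of their closure) that forms a subbase of $X$ and such that $S_{n,1}$ is the exterior (complement of the closure) of $S_{n,0}$ for each $n$. Put $S_{n,\bot}=X\setminus(S_{n,0}\cup S_{n,1})$. For $x\in X$, $\tilde{x}\in\mathbb{T}^\omega$ is given by $\tilde{x}(n)=c$ iff $x\in S_{n,c}$ ($c\in\mathbb{T}$), and $\widetilde{X}=\{\tilde{x}:x\in X\}$. For $p\in\mathbb{T}^\omega$, $S(p)=\bigcap_{k\in\mathrm{dom}(p)}S_{k,p(k)}$ and $\bar{S}(p)=\bigcap_{k\in\mathrm{dom}(p)}\mathrm{cl}\,S_{k,p(k)}$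 (empty intersection is $X$). $S$ is proper if $\mathrm{cl}\,S(e)=\bar{S}(e)$ for every $e\in\mathbb{T}^*$. Let $\uparrow\widetilde{X}=\{p\in\mathbb{T}^\omega: p\sqsupseteq\tilde{x}\text{ for some }x\in X\}$. Define the posets $K_S=\{p|_m:p\in\widetilde{X},m\in\mathbb{N}\}$ and $\widehat{K}_S=\{p|_m:p\in\uparrow\widetilde{X},m\in\mathbb{N}\}$ (subsets of $\mathbb{T}^*$), and let $D_S=\mathrm{Idl}(K_S)$, $\widehat{D}_S=\mathrm{Idl}(\widehat{K}_S)$ be their ideal completions (ideals, i.e. directed downwards-closed subsets, ordered by inclusion), with the Scott topology. Via $I\mapsto\bigsqcup I$ (supremum in $\mathbb{T}^\omega$) they are regarded as subposets of $\mathbb{T}^\omega$; the sets of compact elements are $K_S$ and $\widehat{K}_S$. For a domain (an $\omega$-algebraic pointed dcpo) $D$, $L(D)$ denotes the set of non-compact elements, with the subspace topology. For a poset $P$, $\min(P)$ is the set of minimal elements of $P$. *)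

theory Defs
  imports "HOL-Analysis.Analysis" "HOL-Library.Z2"
begin

section \<open>Posets given as subsets of an ordered type\<close>

text \<open>A poset is a set \<open>P\<close> in a type of class \<open>order\<close>, with the induced order.
  Suprema are always taken inside \<open>P\<close>.\<close>

definition directed_set :: "'a::order set \<Rightarrow> bool" where
  "directed_set A \<longleftrightarrow> A \<noteq> {} \<and> (\<forall>a\<in>A. \<forall>b\<in>A. \<exists>c\<in>A. a \<le> c \<and> b \<le> c)"

definition is_sup_in :: "'a::order set \<Rightarrow> 'a set \<Rightarrow> 'a \<Rightarrow> bool" where
  "is_sup_in P A s \<longleftrightarrow>
     s \<in> P \<and> (\<forall>a\<in>A. a \<le> s) \<and> (\<forall>u\<in>P. (\<forall>a\<in>A. a \<le> u) \<longrightarrow> s \<le> u)"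

definition minimal_elements :: "'a::order set \<Rightarrow> 'a set" where
  "minimal_elements P = {p \<in> P. \<forall>q\<in>P. q \<le> p \<longrightarrow> q = p}"

definition compact_elements :: "'a::order set \<Rightarrow> 'a set" where
  "compact_elements P =
     {c \<in> P. \<forall>A s. A \<subseteq> P \<longrightarrow> directed_set A \<longrightarrow> is_sup_in P A s \<longrightarrow> c \<le> s \<longrightarrow> (\<exists>a\<in>A. c \<le> a)}"

definition limit_elements :: "'a::order set \<Rightarrow> 'a set" where
  "limit_elements P = P - compact_elements P"

definition scott_open :: "'a::order set \<Rightarrow> 'a set \<Rightarrow> bool" where
  "scott_open P U \<longleftrightarrow>
     U \<subseteq> P \<and> (\<forall>x\<in>U. \<forall>y\<in>P. x \<le> y \<longrightarrow> y \<in> U) \<and>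
     (\<forall>A s. A \<subseteq> P \<longrightarrow> directed_set A \<longrightarrow> is_sup_in P A s \<longrightarrow> s \<in> U \<longrightarrow> A \<inter> U \<noteq> {})"

definition scott_topology :: "'a::order set \<Rightarrow> 'a topology" where
  "scott_topology P = topology (scott_open P)"

lemma scott_openI:
  assumes "U \<subseteq> P"
    and "\<And>x y. x \<in> U \<Longrightarrow> y \<in> P \<Longrightarrow> x \<le> y \<Longrightarrow> y \<in> U"
    and "\<And>A s. A \<subseteq> P \<Longrightarrow> directed_set A \<Longrightarrow> is_sup_in P A s \<Longrightarrow> s \<in> U \<Longrightarrow> \<exists>a. a \<in> A \<and> a \<in> U"
  shows "scott_open P U"
  unfolding scott_open_def
proof (intro conjI ballI allI impI)
  fix A s assume "A \<subseteq> P" "directed_set A" "is_sup_in P A s" "s \<in> U"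
  from assms(3)[OF this] show "A \<inter> U \<noteq> {}" by blast
qed (fact assms)+

lemma scott_openD:
  assumes "scott_open P U"
  shows "U \<subseteq> P"
    and "x \<in> U \<Longrightarrow> y \<in> P \<Longrightarrow> x \<le> y \<Longrightarrow> y \<in> U"
    and "A \<subseteq> P \<Longrightarrow> directed_set A \<Longrightarrow> is_sup_in P A s \<Longrightarrow> s \<in> U \<Longrightarrow> \<exists>a. a \<in> A \<and> a \<in> U"
proof -
  note * = assms[unfolded scott_open_def]
  show "U \<subseteq> P" using * by (rule conjunct1)
  show "y \<in> U" if "x \<in> U" "y \<in> P" "x \<le> y"
    using conjunct1[OF conjunct2[OF *]] that by blast
  show "\<exists>a. a \<in> A \<and> a \<in> U" if "A \<subseteq> P" "directed_set A" "is_sup_in P A s" "s \<in> U"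
  proof -
    have "A \<inter> U \<noteq> {}"
      using conjunct2[OF conjunct2[OF *], rule_format, OF that] .
    then show ?thesis by blast
  qed
qed

lemma istopology_scott_open: "istopology (scott_open P)"
  unfolding istopology_def
proof (intro conjI allI impI)
  fix U V assume U: "scott_open P U" and V: "scott_open P V"
  show "scott_open P (U \<inter> V)"
  proof (rule scott_openI)
    show "U \<inter> V \<subseteq> P" using scott_openD(1)[OF U] by (rule le_infI1)
  next
    fix x y assume "x \<in> U \<inter> V" "y \<in> P" "x \<le> y"
    then show "y \<in> U \<inter> V"
      using scott_openD(2)[OF U, of x y] scott_openD(2)[OF V, of x y] by simp
  next
    fix A s assume A: "A \<subseteq> P" "directed_set A" "is_sup_in P A s" and s: "s \<in> U \<inter> V"
    obtain u where u: "u \<in> A" "u \<in> U" using scott_openD(3)[OF U A] s by auto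
    obtain v where v: "v \<in> A" "v \<in> V" using scott_openD(3)[OF V A] s by auto
    obtain w where w: "w \<in> A" "u \<le> w" "v \<le> w"
      using A(2) u(1) v(1) unfolding directed_set_def by blast
    have "w \<in> P" using w(1) A(1) by (rule rev_subsetD)
    then have "w \<in> U" "w \<in> V"
      using scott_openD(2)[OF U u(2)] scott_openD(2)[OF V v(2)] w by simp_all
    then show "\<exists>a. a \<in> A \<and> a \<in> U \<inter> V" using w(1) by (intro exI[of _ w]) simp
  qed
next
  fix K assume K: "\<forall>U\<in>K. scott_open P U"
  show "scott_open P (\<Union>K)"
  proof (rule scott_openI)
    show "\<Union>K \<subseteq> P" by (rule Union_least) (rule scott_openD(1)[OF K[rule_format]])
  next
    fix x y assume x: "x \<in> \<Union>K" and y: "y \<in> P" "x \<le> y"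
    from x obtain U where U: "U \<in> K" "x \<in> U" by (rule UnionE)
    show "y \<in> \<Union>K"
      using U(1) scott_openD(2)[OF K[rule_format, OF U(1)] U(2) y] by (rule UnionI)
  next
    fix A s assume A: "A \<subseteq> P" "directed_set A" "is_sup_in P A s" and s: "s \<in> \<Union>K"
    from s obtain U where U: "U \<in> K" "s \<in> U" by (rule UnionE)
    obtain a where "a \<in> A" "a \<in> U" using scott_openD(3)[OF K[rule_format, OF U(1)] A U(2)] by auto
    then show "\<exists>a. a \<in> A \<and> a \<in> \<Union>K" using U(1) by (intro exI[of _ a]) auto
  qed
qed

lemma openin_scott_topology: "openin (scott_topology P) U \<longleftrightarrow> scott_open P U"
  by (simp add: scott_topology_def istopology_scott_open topology_inverse')

lemma topspace_scott_topology [simp]: "topspace (scott_topology P) = P"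
proof -
  have "scott_open P P"
  proof (rule scott_openI)
    fix A s assume "A \<subseteq> P" "directed_set A"
    then show "\<exists>a. a \<in> A \<and> a \<in> P" unfolding directed_set_def by (meson equals0I subsetD)
  qed simp_all
  then show ?thesis
    unfolding topspace_def openin_scott_topology by (auto dest: scott_openD(1))
qed

definition limit_space :: "'a::order set \<Rightarrow> 'a topology" where
  "limit_space P = subtopology (scott_topology P) (limit_elements P)"

text \<open>The ideal completion; the inclusion order is the order of the type of sets.\<close>

definition ideal_completion :: "'a::order set \<Rightarrow> 'a set set" where
  "ideal_completion K =
     {I. I \<subseteq> K \<and> directed_set I \<and> (\<forall>a\<in>I. \<forall>b\<in>K. b \<le> a \<longrightarrow> b \<in> I)}"

section \<open>Sequences over the flat three-element poset\<close>

datatype tern = Undef (\<open>\<bottom>\<^sub>T\<close>) | Digit bit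

instantiation tern :: order
begin

definition less_eq_tern :: "tern \<Rightarrow> tern \<Rightarrow> bool" where
  "c \<le> d \<longleftrightarrow> c = \<bottom>\<^sub>T \<or> c = d"

definition less_tern :: "tern \<Rightarrow> tern \<Rightarrow> bool" where
  "(c::tern) < d \<longleftrightarrow> c \<le> d \<and> c \<noteq> d"

instance
  by standard (auto simp: less_eq_tern_def less_tern_def)

end

text \<open>The order on \<open>tseq\<close> is the pointwise order of the function type, i.e.\ the product order.\<close>

type_synonym tseq = "nat \<Rightarrow> tern"

definition tdom :: "tseq \<Rightarrow> nat set" where
  "tdom p = {k. p k \<noteq> \<bottom>\<^sub>T}"

definition tfin :: "tseq set" where
  "tfin = {p. finite (tdom p)}"

definition trunc :: "tseq \<Rightarrow> nat \<Rightarrow> tseq" where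
  "trunc p m = (\<lambda>k. if k < m then p k else \<bottom>\<^sub>T)"

text \<open>The ideal completion of a poset \<open>K\<close> of finite sequences, realised as a subposet of all
  sequences by taking suprema of ideals. The lemma \<open>sup_ideals_order_iso\<close> below shows that this
  is an order isomorphism, so that compact elements, minimal elements and the Scott topology
  (all defined from the order) agree with those of the ideal completion;
  \<open>compact_elements_sup_ideals\<close> shows that the compact elements are exactly \<open>K\<close>.\<close>

definition sup_ideals :: "tseq set \<Rightarrow> tseq set" where
  "sup_ideals K = {p. \<exists>I \<in> ideal_completion K. is_sup_in UNIV I p}"

lemma directed_tseq_sup:
  fixes A :: "tseq set"
  assumes "directed_set A"
  obtains p where "is_sup_in UNIV A p" "\<And>k. p k \<noteq> \<bottom>\<^sub>T \<Longrightarrow> \<exists>a\<in>A. a k = p k"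
proof -
  define p where
    "p k = (if \<exists>a\<in>A. a k \<noteq> \<bottom>\<^sub>T then (SOME a. a \<in> A \<and> a k \<noteq> \<bottom>\<^sub>T) k else \<bottom>\<^sub>T)" for k
  have some: "\<exists>a\<in>A. a k = p k \<and> p k \<noteq> \<bottom>\<^sub>T" if "\<exists>a\<in>A. a k \<noteq> \<bottom>\<^sub>T" for k
    using someI_ex[of "\<lambda>a. a \<in> A \<and> a k \<noteq> \<bottom>\<^sub>T"] that unfolding p_def by (metis (mono_tags, lifting))
  have ub: "a \<le> p" if a: "a \<in> A" for a
  proof (rule le_funI)
    fix k
    show "a k \<le> p k"
    proof (cases "a k = \<bottom>\<^sub>T")
      case False
      then obtain b where b: "b \<in> A" "b k = p k" "p k \<noteq> \<bottom>\<^sub>T" using some a by blast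
      obtain c where "c \<in> A" "a \<le> c" "b \<le> c" using assms a b unfolding directed_set_def by blast
      then have "a k \<le> c k" "b k \<le> c k" by (auto simp: le_fun_def)
      then show ?thesis using False b by (auto simp: less_eq_tern_def)
    qed (simp add: less_eq_tern_def)
  qed
  have att: "\<exists>a\<in>A. a k = p k" if "p k \<noteq> \<bottom>\<^sub>T" for k
    using that some[of k] by (metis p_def)
  have "p \<le> u" if "\<forall>a\<in>A. a \<le> u" for u
  proof (rule le_funI)
    fix k show "p k \<le> u k"
      using att[of k] that by (metis le_funD less_eq_tern_def)
  qed
  with ub have "is_sup_in UNIV A p" by (simp add: is_sup_in_def)
  then show ?thesis using that att by blast
qed

lemma is_sup_in_unique: "is_sup_in P A s \<Longrightarrow> is_sup_in P A t \<Longrightarrow> s = t"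
  by (meson is_sup_in_def order_antisym)

lemma finite_below_directed_sup:
  fixes A :: "tseq set"
  assumes A: "directed_set A" "is_sup_in UNIV A p" and e: "e \<in> tfin" "e \<le> p"
  shows "\<exists>a\<in>A. e \<le> a"
proof -
  have att: "\<exists>a\<in>A. a k = p k" if "p k \<noteq> \<bottom>\<^sub>T" for k
    using directed_tseq_sup[OF A(1)] is_sup_in_unique[OF A(2)] that by metis
  have "\<exists>a\<in>A. \<forall>k\<in>F. e k \<le> a k" if "finite F" for F
    using that
  proof induction
    case empty
    then show ?case using A(1) by (auto simp: directed_set_def)
  next
    case (insert k F)
    then obtain a where a: "a \<in> A" "\<forall>k\<in>F. e k \<le> a k" by blast
    have "\<exists>b\<in>A. e k \<le> b k"
      using a(1) att[of k] e(2) by (metis le_funD less_eq_tern_def)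
    then obtain b where b: "b \<in> A" "e k \<le> b k" by blast
    obtain c where c: "c \<in> A" "a \<le> c" "b \<le> c"
      using A(1) a b unfolding directed_set_def by blast
    then have "\<forall>j\<in>insert k F. e j \<le> c j"
      using a b by (metis insertE le_funD order_trans)
    then show ?case using c by blast
  qed
  then obtain a where a: "a \<in> A" "\<forall>k\<in>tdom e. e k \<le> a k" using e by (auto simp: tfin_def)
  then have "e \<le> a"
    by (auto simp: le_fun_def tdom_def less_eq_tern_def)
  then show ?thesis using a by blast
qed

lemma sup_ideals_order_iso:
  assumes K: "K \<subseteq> tfin"
  obtains f where "bij_betw f (ideal_completion K) (sup_ideals K)"
    "\<And>I. I \<in> ideal_completion K \<Longrightarrow> is_sup_in UNIV I (f I)"
    "\<And>I J. I \<in> ideal_completion K \<Longrightarrow> J \<in> ideal_completion K \<Longrightarrow> f I \<le> f J \<longleftrightarrow> I \<le> J"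
proof -
  define f where "f I = (SOME p. is_sup_in UNIV I p)" for I :: "tseq set"
  have f: "is_sup_in UNIV I (f I)" if "I \<in> ideal_completion K" for I
    unfolding f_def using that directed_tseq_sup[of I]
    by (metis (mono_tags, lifting) ideal_completion_def mem_Collect_eq someI_ex)
  have le: "f I \<le> f J \<longleftrightarrow> I \<le> J" if I: "I \<in> ideal_completion K" and J: "J \<in> ideal_completion K" for I J
  proof
    assume IJ: "f I \<le> f J"
    show "I \<le> J"
    proof
      fix e assume e: "e \<in> I"
      then have "e \<le> f J" using IJ f[OF I] by (meson is_sup_in_def order_trans)
      moreover have "e \<in> K" using e I by (auto simp: ideal_completion_def)
      moreover have "directed_set J" using J by (auto simp: ideal_completion_def)
      ultimately obtain a where "a \<in> J" "e \<le> a"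
        using finite_below_directed_sup f[OF J] K by blast
      then show "e \<in> J" using \<open>e \<in> K\<close> J by (auto simp: ideal_completion_def)
    qed
  next
    assume "I \<le> J"
    then show "f I \<le> f J"
      using f[OF I] f[OF J] by (meson UNIV_I is_sup_in_def subset_iff)
  qed
  have "inj_on f (ideal_completion K)"
    by (rule inj_onI) (metis le order_antisym order_refl)
  moreover have "f ` ideal_completion K = sup_ideals K"
    using f is_sup_in_unique unfolding sup_ideals_def by blast
  ultimately show ?thesis using that f le by (auto simp: bij_betw_def)
qed

lemma compact_elements_sup_ideals:
  assumes K: "K \<subseteq> tfin"
  shows "compact_elements (sup_ideals K) = K"
proof
  have ideal_of: "\<exists>I. I \<subseteq> K \<and> directed_set I \<and> is_sup_in UNIV I p" if "p \<in> sup_ideals K" for p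
    using that unfolding sup_ideals_def ideal_completion_def by blast
  have KD: "K \<subseteq> sup_ideals K"
  proof
    fix e assume "e \<in> K"
    then have "{a \<in> K. a \<le> e} \<in> ideal_completion K"
      unfolding ideal_completion_def directed_set_def by (auto intro: order_trans)
    moreover have "is_sup_in UNIV {a \<in> K. a \<le> e} e"
      using \<open>e \<in> K\<close> by (auto simp: is_sup_in_def)
    ultimately show "e \<in> sup_ideals K" unfolding sup_ideals_def by blast
  qed
  show "compact_elements (sup_ideals K) \<subseteq> K"
  proof
    fix c assume c: "c \<in> compact_elements (sup_ideals K)"
    then have cD: "c \<in> sup_ideals K" by (simp add: compact_elements_def)
    then obtain I where I: "I \<subseteq> K" "directed_set I" "is_sup_in UNIV I c" using ideal_of by blast
    have "is_sup_in (sup_ideals K) I c" using I(3) cD by (simp add: is_sup_in_def)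
    moreover have "I \<subseteq> sup_ideals K" using I(1) KD by (rule order_trans)
    moreover have "\<forall>A s. A \<subseteq> sup_ideals K \<longrightarrow> directed_set A \<longrightarrow> is_sup_in (sup_ideals K) A s
        \<longrightarrow> c \<le> s \<longrightarrow> (\<exists>a\<in>A. c \<le> a)"
      using c by (simp add: compact_elements_def)
    ultimately have "\<exists>a\<in>I. c \<le> a"
      using I(2) by simp
    then obtain a where a: "a \<in> I" "c \<le> a" by blast
    then have "a \<le> c" using I(3) by (simp add: is_sup_in_def)
    then have "a = c" using a(2) by (rule order_antisym)
    then show "c \<in> K" using a(1) I(1) by auto
  qed
  show "K \<subseteq> compact_elements (sup_ideals K)"
  proof
    fix e assume e: "e \<in> K"
    have "\<exists>a\<in>A. e \<le> a"
      if A: "A \<subseteq> sup_ideals K" "directed_set A" and s: "is_sup_in (sup_ideals K) A s" "e \<le> s" for A s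
    proof -
      obtain p where p: "is_sup_in UNIV A p" using directed_tseq_sup[OF A(2)] by blast
      define I where "I = {d \<in> K. d \<le> p}"
      have ub: "\<exists>d\<in>I. d1 \<le> d \<and> d2 \<le> d" if d: "d1 \<in> I" "d2 \<in> I" for d1 d2
      proof -
        obtain a1 where a1: "a1 \<in> A" "d1 \<le> a1"
          using finite_below_directed_sup[OF A(2) p, of d1] d(1) K by (auto simp: I_def)
        obtain a2 where a2: "a2 \<in> A" "d2 \<le> a2"
          using finite_below_directed_sup[OF A(2) p, of d2] d(2) K by (auto simp: I_def)
        obtain a where a: "a \<in> A" "a1 \<le> a" "a2 \<le> a"
          using A(2) a1(1) a2(1) unfolding directed_set_def by blast
        obtain J where J: "J \<subseteq> K" "directed_set J" "is_sup_in UNIV J a"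
          using ideal_of a(1) A(1) by blast
        obtain b1 where b1: "b1 \<in> J" "d1 \<le> b1"
          using finite_below_directed_sup[OF J(2,3), of d1] d(1) K a1(2) a(2)
          by (auto simp: I_def intro: order_trans)
        obtain b2 where b2: "b2 \<in> J" "d2 \<le> b2"
          using finite_below_directed_sup[OF J(2,3), of d2] d(2) K a2(2) a(3)
          by (auto simp: I_def intro: order_trans)
        obtain b where b: "b \<in> J" "b1 \<le> b" "b2 \<le> b"
          using J(2) b1(1) b2(1) unfolding directed_set_def by blast
        have "b \<le> a" using J(3) b(1) by (simp add: is_sup_in_def)
        also have "a \<le> p" using p a(1) by (simp add: is_sup_in_def)
        finally have "b \<in> I" using b(1) J(1) by (auto simp: I_def)
        then show ?thesis using b b1(2) b2(2) by (meson order_trans)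
      qed
      have below: "\<exists>J\<subseteq>I. directed_set J \<and> is_sup_in UNIV J a" if a: "a \<in> A" for a
      proof -
        obtain J where J: "J \<subseteq> K" "directed_set J" "is_sup_in UNIV J a"
          using ideal_of a A(1) by blast
        have "a \<le> p" using p a by (simp add: is_sup_in_def)
        then have "J \<subseteq> I" using J(1,3) by (auto simp: I_def is_sup_in_def intro: order_trans)
        then show ?thesis using J by blast
      qed
      have "I \<noteq> {}"
        using below A(2) unfolding directed_set_def by blast
      then have "I \<in> ideal_completion K"
        using ub unfolding ideal_completion_def directed_set_def
        by (auto simp: I_def intro: order_trans)
      moreover have "is_sup_in UNIV I p"
      proof -
        have "p \<le> u" if u: "\<forall>d\<in>I. d \<le> u" for u
        proof -
          have "a \<le> u" if "a \<in> A" for a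
            using below[OF that] u unfolding is_sup_in_def by blast
          then show ?thesis using p by (simp add: is_sup_in_def)
        qed
        then show ?thesis by (simp add: is_sup_in_def I_def)
      qed
      ultimately have "p \<in> sup_ideals K" unfolding sup_ideals_def by blast
      then have "is_sup_in (sup_ideals K) A p" using p by (simp add: is_sup_in_def)
      then have "s = p" using s(1) by (meson is_sup_in_unique)
      then show ?thesis
        using finite_below_directed_sup[OF A(2) p, of e] e K s(2) by blast
    qed
    moreover have "e \<in> sup_ideals K" using e KD by (rule rev_subsetD)
    ultimately show "e \<in> compact_elements (sup_ideals K)"
      unfolding compact_elements_def by (intro CollectI conjI allI impI)
  qed
qed

section \<open>Dyadic subbases\<close>

definition dyadic_subbase :: "'a topology \<Rightarrow> (nat \<Rightarrow> bit \<Rightarrow> 'a set) \<Rightarrow> bool" where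
  "dyadic_subbase X S \<longleftrightarrow>
     (\<forall>n a. openin X (S n a) \<and> X interior_of (X closure_of S n a) = S n a) \<and>
     X = topology (arbitrary union_of
           (finite intersection_of (\<lambda>U. \<exists>n a. U = S n a) relative_to topspace X)) \<and>
     (\<forall>n. S n 1 = topspace X - X closure_of S n 0)"

text \<open>\<open>cell X S n \<bottom>\<^sub>T\<close> is what neither digit covers; \<open>code X S x\<close> is the sequence
  usually written \<open>x\<close> with a tilde. It is well defined by \<open>code_eq_iff\<close>.\<close>

definition cell :: "'a topology \<Rightarrow> (nat \<Rightarrow> bit \<Rightarrow> 'a set) \<Rightarrow> nat \<Rightarrow> tern \<Rightarrow> 'a set" where
  "cell X S n c = (case c of Digit a \<Rightarrow> S n a | \<bottom>\<^sub>T \<Rightarrow> topspace X - (S n 0 \<union> S n 1))"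

definition code :: "'a topology \<Rightarrow> (nat \<Rightarrow> bit \<Rightarrow> 'a set) \<Rightarrow> 'a \<Rightarrow> tseq" where
  "code X S x = (\<lambda>n. THE c. x \<in> cell X S n c)"

lemma code_eq_iff:
  assumes S: "dyadic_subbase X S" and x: "x \<in> topspace X"
  shows "code X S x n = c \<longleftrightarrow> x \<in> cell X S n c"
proof -
  have "S n 0 \<subseteq> X closure_of S n 0"
    using S by (meson closure_of_subset dyadic_subbase_def openin_subset)
  then have disj: "S n 0 \<inter> S n 1 = {}"
    using S by (auto simp: dyadic_subbase_def)
  have in_S: "x \<in> S n 0 \<or> x \<in> S n 1" if "x \<in> S n a" for a
    using that by (cases a) simp_all
  have "\<exists>!c. x \<in> cell X S n c"
  proof (rule ex_ex1I)
    show "\<exists>c. x \<in> cell X S n c"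
    proof (cases "\<exists>a. x \<in> S n a")
      case True
      then obtain a where "x \<in> S n a" by blast
      then have "x \<in> cell X S n (Digit a)" by (simp add: cell_def)
      then show ?thesis by blast
    next
      case False
      then have "x \<in> cell X S n \<bottom>\<^sub>T" using x by (simp add: cell_def)
      then show ?thesis by blast
    qed
  next
    fix c d assume "x \<in> cell X S n c" "x \<in> cell X S n d"
    moreover have "a = b" if "x \<in> S n a" "x \<in> S n b" for a b
      using that disj by (cases a; cases b) (simp_all, blast+)
    ultimately show "c = d"
      using in_S by (cases c; cases d) (auto simp: cell_def)
  qed
  from theI'[OF this] this show ?thesis
    unfolding code_def by blast
qed

definition codes :: "'a topology \<Rightarrow> (nat \<Rightarrow> bit \<Rightarrow> 'a set) \<Rightarrow> tseq set" where
  "codes X S = code X S ` topspace X"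

definition up_codes :: "'a topology \<Rightarrow> (nat \<Rightarrow> bit \<Rightarrow> 'a set) \<Rightarrow> tseq set" where
  "up_codes X S = {p. \<exists>x \<in> topspace X. code X S x \<le> p}"

text \<open>Intersecting with \<open>topspace X\<close> makes the empty intersection the whole space.\<close>

definition cell_Inter :: "'a topology \<Rightarrow> (nat \<Rightarrow> bit \<Rightarrow> 'a set) \<Rightarrow> tseq \<Rightarrow> 'a set" where
  "cell_Inter X S p = topspace X \<inter> (\<Inter>k\<in>tdom p. cell X S k (p k))"

definition closed_cell_Inter :: "'a topology \<Rightarrow> (nat \<Rightarrow> bit \<Rightarrow> 'a set) \<Rightarrow> tseq \<Rightarrow> 'a set" where
  "closed_cell_Inter X S p = topspace X \<inter> (\<Inter>k\<in>tdom p. X closure_of cell X S k (p k))"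

definition proper_dyadic_subbase :: "'a topology \<Rightarrow> (nat \<Rightarrow> bit \<Rightarrow> 'a set) \<Rightarrow> bool" where
  "proper_dyadic_subbase X S \<longleftrightarrow>
     dyadic_subbase X S \<and>
     (\<forall>e\<in>tfin. X closure_of cell_Inter X S e = closed_cell_Inter X S e)"

definition dyadic_K :: "'a topology \<Rightarrow> (nat \<Rightarrow> bit \<Rightarrow> 'a set) \<Rightarrow> tseq set" where
  "dyadic_K X S = {trunc p m | p m. p \<in> codes X S}"

definition dyadic_K_hat :: "'a topology \<Rightarrow> (nat \<Rightarrow> bit \<Rightarrow> 'a set) \<Rightarrow> tseq set" where
  "dyadic_K_hat X S = {trunc p m | p m. p \<in> up_codes X S}"

lemma trunc_tfin: "trunc p m \<in> tfin"
proof -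
  have "tdom (trunc p m) \<subseteq> {..<m}" by (auto simp: tdom_def trunc_def)
  then show ?thesis using finite_subset by (auto simp: tfin_def)
qed

lemma dyadic_K_subset_tfin: "dyadic_K X S \<subseteq> tfin"
  and dyadic_K_hat_subset_tfin: "dyadic_K_hat X S \<subseteq> tfin"
  using trunc_tfin by (auto simp: dyadic_K_def dyadic_K_hat_def)

definition dyadic_D :: "'a topology \<Rightarrow> (nat \<Rightarrow> bit \<Rightarrow> 'a set) \<Rightarrow> tseq set" where
  "dyadic_D X S = sup_ideals (dyadic_K X S)"

definition dyadic_D_hat :: "'a topology \<Rightarrow> (nat \<Rightarrow> bit \<Rightarrow> 'a set) \<Rightarrow> tseq set" where
  "dyadic_D_hat X S = sup_ideals (dyadic_K_hat X S)"

end

theory Submission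
  imports Defs
begin

text \<open>Let \<open>P\<close> be the set of codes, or the set of all sequences above a code, and let \<open>E\<close> be the
  ideal completion of the truncations of elements of \<open>P\<close>, realised inside the sequences. Then \<open>E\<close>
  consists of the sequences all of whose truncations are truncations of elements of \<open>P\<close>
  (\<open>sup_ideals_truncations\<close>), it is closed under directed suprema of sequences
  (\<open>sup_in_truncations_is_sup\<close>), and its limit elements are its members with infinite domain
  (\<open>limit_elements_truncations\<close>).

  If \<open>p\<close> is a limit element, then for every \<open>m\<close> there is a point whose code lies below \<open>p\<close> on
  the first \<open>m\<close> places. The points with this property form a decreasing sequence of
  nonempty closed sets, so by compactness some point \<open>x\<close> has its whole code below \<open>p\<close>
  (\<open>code_below_limit_exists\<close>). This point is unique: properness and regularity give a finite
  part \<open>e\<close> of the code of \<open>x\<close> for which the intersection of the closed cells of \<open>e\<close> avoids any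
  prescribed \<open>y \<noteq> x\<close>, whereas every point with code below \<open>p\<close> lies in these closed cells
  (\<open>code_below_unique\<close>).

  Conversely every code has infinite domain, since a point whose code has finite domain would be
  isolated, hence on the boundary of no cell, and its code would be defined everywhere
  (\<open>infinite_tdom_code\<close>). So codes are limit elements. Together, below every limit element there is exactly one code, and therefore the
  codes are the minimal limit elements. Sending \<open>p\<close> to the unique point with code below it is a
  left inverse of the coding map. It is continuous by the same closed-cell estimate, because the
  elements above a fixed finite sequence form a Scott open set. So the coding map is a section,
  which gives both the embedding and the retraction.\<close>

section \<open>Truncations and the ideal completion\<close>

lemma trunc_le: "trunc p m \<le> p"
  by (auto simp: le_fun_def trunc_def less_eq_tern_def)

lemma trunc_mono: "p \<le> q \<Longrightarrow> trunc p m \<le> trunc q m"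
  by (auto simp: le_fun_def trunc_def less_eq_tern_def)

lemma trunc_mono_length: "m \<le> n \<Longrightarrow> trunc p m \<le> trunc p n"
  by (auto simp: le_fun_def trunc_def less_eq_tern_def)

lemma trunc_trunc: "trunc (trunc p m) n = trunc p (min m n)"
  by (auto simp: trunc_def)

lemma trunc_le_iff: "trunc p m \<le> q \<longleftrightarrow> (\<forall>k<m. p k \<le> q k)"
  by (auto simp: le_fun_def trunc_def less_eq_tern_def)

lemma trunc_eq_of_between: "trunc p m \<le> e \<Longrightarrow> e \<le> p \<Longrightarrow> trunc e m = trunc p m"
  using trunc_mono[of "trunc p m" e m] trunc_mono[of e p m] by (simp add: trunc_trunc order_antisym)

lemma tfin_eq_trunc:
  assumes "p \<in> tfin"
  obtains m where "trunc p m = p"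
proof -
  from assms obtain m where "\<forall>k\<in>tdom p. k < m"
    using finite_nat_set_iff_bounded unfolding tfin_def by auto
  then have "trunc p m = p" by (force simp: trunc_def tdom_def fun_eq_iff)
  then show thesis by (rule that)
qed

lemma le_iff_trunc_le: "p \<le> q \<longleftrightarrow> (\<forall>m. trunc p m \<le> q)"
  unfolding trunc_le_iff le_fun_def[of p q] by (meson lessI)

lemma is_sup_in_truncs: "is_sup_in UNIV (range (trunc p)) p"
  using trunc_le by (auto simp: is_sup_in_def le_iff_trunc_le[of p])

lemma directed_truncs: "directed_set (range (trunc p))"
  unfolding directed_set_def
  by (auto intro: trunc_mono_length[OF max.cobounded1] trunc_mono_length[OF max.cobounded2])

text \<open>For \<open>P\<close> the set of codes this is \<open>dyadic_K\<close>, for \<open>P\<close> the set of sequences above codes it is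
  \<open>dyadic_K_hat\<close>.\<close>

definition truncations :: "tseq set \<Rightarrow> tseq set" where
  "truncations P = {trunc p m | p m. p \<in> P}"

lemma truncationsI: "p \<in> P \<Longrightarrow> trunc p m \<in> truncations P"
  by (auto simp: truncations_def)

lemma truncations_subset_tfin: "truncations P \<subseteq> tfin"
  using trunc_tfin by (auto simp: truncations_def)

lemma trunc_in_truncations: "e \<in> truncations P \<Longrightarrow> trunc e m \<in> truncations P"
  by (force simp: truncations_def trunc_trunc)

lemma sup_ideals_truncations:
  "sup_ideals (truncations P) = {p. \<forall>m. trunc p m \<in> truncations P}"
proof (intro set_eqI iffI CollectI allI; (elim CollectE)?)
  fix p m assume "p \<in> sup_ideals (truncations P)"
  then obtain I where I: "I \<subseteq> truncations P" "directed_set I" "is_sup_in UNIV I p"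
    by (auto simp: sup_ideals_def ideal_completion_def)
  then obtain e where e: "e \<in> I" "trunc p m \<le> e"
    using finite_below_directed_sup trunc_tfin trunc_le by blast
  moreover have "e \<le> p" using I(3) e(1) by (simp add: is_sup_in_def)
  ultimately have "trunc p m = trunc e m" by (simp add: trunc_eq_of_between)
  then show "trunc p m \<in> truncations P" using e(1) I(1) trunc_in_truncations by auto
next
  fix p assume p: "\<forall>m. trunc p m \<in> truncations P"
  define I where "I = {e \<in> truncations P. e \<le> p}"
  have sub: "range (trunc p) \<subseteq> I" using p trunc_le by (auto simp: I_def)
  have cof: "\<exists>m. e \<le> trunc p m" if "e \<in> I" for e
    using finite_below_directed_sup[OF directed_truncs is_sup_in_truncs, of e p] that truncations_subset_tfin
    by (auto simp: I_def)
  have "\<exists>c\<in>I. a \<le> c \<and> b \<le> c" if ab: "a \<in> I" "b \<in> I" for a b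
  proof -
    obtain m n where "a \<le> trunc p m" "b \<le> trunc p n" using cof ab by blast
    then have "a \<le> trunc p (max m n)" "b \<le> trunc p (max m n)"
      by (meson max.cobounded1 max.cobounded2 order_trans trunc_mono_length)+
    then show ?thesis using sub by blast
  qed
  moreover have "I \<noteq> {}" using sub by blast
  ultimately have "I \<in> ideal_completion (truncations P)"
    by (auto simp: ideal_completion_def directed_set_def I_def intro: order_trans)
  moreover have "is_sup_in UNIV I p"
    using sub by (auto simp: is_sup_in_def I_def le_iff_trunc_le[of p])
  ultimately show "p \<in> sup_ideals (truncations P)" by (auto simp: sup_ideals_def)
qed

text \<open>Directed suprema taken inside the completion are pointwise suprema of sequences, so that
  finite parts of a supremum are already reached by a member of the directed set.\<close>

lemma sup_in_truncations_is_sup: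
  assumes A: "A \<subseteq> sup_ideals (truncations P)" "directed_set A"
    and s: "is_sup_in (sup_ideals (truncations P)) A s"
  shows "is_sup_in UNIV A s"
proof -
  obtain p where p: "is_sup_in UNIV A p" using directed_tseq_sup[OF A(2)] by blast
  have "trunc p m \<in> truncations P" for m
  proof -
    obtain a where a: "a \<in> A" "trunc p m \<le> a"
      using finite_below_directed_sup[OF A(2) p] trunc_tfin trunc_le by blast
    moreover have "a \<le> p" using p a(1) by (simp add: is_sup_in_def)
    ultimately have "trunc p m = trunc a m" by (simp add: trunc_eq_of_between)
    then show ?thesis using a(1) A(1) by (auto simp: sup_ideals_truncations)
  qed
  then have "p \<in> sup_ideals (truncations P)" by (simp add: sup_ideals_truncations)
  then have "is_sup_in (sup_ideals (truncations P)) A p" using p by (simp add: is_sup_in_def)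
  then show ?thesis using p s is_sup_in_unique by blast
qed

lemma limit_elements_truncations:
  "limit_elements (sup_ideals (truncations P)) = {p \<in> sup_ideals (truncations P). infinite (tdom p)}"
proof -
  have "p \<in> truncations P \<longleftrightarrow> finite (tdom p)" if "p \<in> sup_ideals (truncations P)" for p
    using that tfin_eq_trunc[of p] truncations_subset_tfin[of P]
    by (metis (mono_tags, lifting) mem_Collect_eq subsetD sup_ideals_truncations tfin_def)
  then show ?thesis
    by (auto simp: limit_elements_def compact_elements_sup_ideals[OF truncations_subset_tfin])
qed

text \<open>Here \<open>e\<close> need not belong to the completion.\<close>

lemma scott_open_above_finite:
  assumes "e \<in> tfin"
  shows "scott_open (sup_ideals (truncations P)) {p \<in> sup_ideals (truncations P). e \<le> p}"
proof (rule scott_openI)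
  fix A s assume A: "A \<subseteq> sup_ideals (truncations P)" "directed_set A"
    "is_sup_in (sup_ideals (truncations P)) A s" "s \<in> {p \<in> sup_ideals (truncations P). e \<le> p}"
  then have "\<exists>a\<in>A. e \<le> a"
    using finite_below_directed_sup sup_in_truncations_is_sup assms by blast
  then show "\<exists>a. a \<in> A \<and> a \<in> {p \<in> sup_ideals (truncations P). e \<le> p}" using A(1) by blast
next
  fix x y assume "x \<in> {p \<in> sup_ideals (truncations P). e \<le> p}" "y \<in> sup_ideals (truncations P)" "x \<le> y"
  then show "y \<in> {p \<in> sup_ideals (truncations P). e \<le> p}" using order_trans[of e x y] by simp
qed blast

lemma scott_open_contains_trunc:
  assumes "scott_open (sup_ideals (truncations P)) U" "p \<in> U"
  shows "\<exists>m. trunc p m \<in> U"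
proof -
  have p: "p \<in> sup_ideals (truncations P)" using assms scott_openD(1) by blast
  then have "range (trunc p) \<subseteq> sup_ideals (truncations P)"
    by (auto simp: sup_ideals_truncations trunc_in_truncations)
  moreover have "is_sup_in (sup_ideals (truncations P)) (range (trunc p)) p"
    using is_sup_in_truncs[of p] p by (simp add: is_sup_in_def)
  ultimately show ?thesis
    using scott_openD(3)[OF assms(1) _ directed_truncs] assms(2) by blast
qed

section \<open>Codes and cells of a dyadic subbase\<close>

lemma openin_dyadic: "dyadic_subbase X S \<Longrightarrow> openin X (S n a)"
  by (simp add: dyadic_subbase_def)

text \<open>The relation between the two cells at a place is symmetric, by regular openness.\<close>

lemma closure_of_dyadic:
  assumes S: "dyadic_subbase X S" and "a \<noteq> b"
  shows "X closure_of S n a = topspace X - S n b"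
proof -
  have reg: "X interior_of (X closure_of S n 0) = S n 0"
    and ext: "S n 1 = topspace X - X closure_of S n 0"
    using S by (auto simp: dyadic_subbase_def)
  have "X closure_of S n 0 = topspace X - S n 1"
    using closure_of_subset_topspace[of X "S n 0"] ext by blast
  moreover have "X closure_of S n 1 = topspace X - S n 0"
    unfolding ext closure_of_complement reg ..
  ultimately show ?thesis using \<open>a \<noteq> b\<close> by (cases a; cases b) auto
qed

lemma code_eq_Digit_iff:
  assumes "dyadic_subbase X S" "x \<in> topspace X"
  shows "code X S x n = Digit a \<longleftrightarrow> x \<in> S n a"
  using code_eq_iff[OF assms] by (simp add: cell_def)

lemma code_le_iff:
  assumes "dyadic_subbase X S" "x \<in> topspace X"
  shows "code X S x n \<le> c \<longleftrightarrow> (\<forall>b. x \<in> S n b \<longrightarrow> Digit b = c)"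
  using code_eq_Digit_iff[OF assms, of n, symmetric]
  by (cases "code X S x n") (auto simp: less_eq_tern_def)

lemma closedin_code_le:
  assumes S: "dyadic_subbase X S"
  shows "closedin X {x \<in> topspace X. code X S x n \<le> c}"
proof -
  have "{x \<in> topspace X. code X S x n \<le> c} = topspace X - (\<Union>b\<in>{b. Digit b \<noteq> c}. S n b)"
    using code_le_iff[OF S] by auto
  then show ?thesis using openin_dyadic[OF S] by (auto intro!: openin_Union)
qed

lemma mem_cell_Inter_iff:
  assumes S: "dyadic_subbase X S"
  shows "x \<in> cell_Inter X S e \<longleftrightarrow> x \<in> topspace X \<and> e \<le> code X S x"
proof -
  have "x \<in> cell X S k (e k) \<longleftrightarrow> e k = code X S x k" if "x \<in> topspace X" for k
    using code_eq_iff[OF S that] by metis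
  then show ?thesis
    by (auto simp: cell_Inter_def tdom_def le_fun_def less_eq_tern_def)
qed

lemma openin_cell_Inter:
  assumes S: "dyadic_subbase X S" and "e \<in> tfin"
  shows "openin X (cell_Inter X S e)"
proof -
  have "openin X (cell X S k (e k))" if "k \<in> tdom e" for k
    using that openin_dyadic[OF S] by (cases "e k") (auto simp: tdom_def cell_def)
  then show ?thesis
    using assms(2) unfolding cell_Inter_def tfin_def
    by (cases "tdom e = {}") (auto intro!: openin_INT)
qed

text \<open>If the code of \<open>y\<close> and the sequence \<open>e\<close> have a common upper bound, then \<open>y\<close> lies in no cell
  opposite to one of \<open>e\<close>, that is, in all closed cells of \<open>e\<close>.\<close>

lemma mem_closed_cell_Inter:
  assumes S: "dyadic_subbase X S" and y: "y \<in> topspace X"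
    and le: "code X S y \<le> p" "e \<le> p"
  shows "y \<in> closed_cell_Inter X S e"
proof -
  have "y \<in> X closure_of cell X S k (e k)" if "k \<in> tdom e" for k
  proof -
    have "e k \<noteq> \<bottom>\<^sub>T" using that by (simp add: tdom_def)
    then obtain a where a: "e k = Digit a" by (cases "e k") simp_all
    moreover have "p k = Digit a" using le_funD[OF le(2), of k] a by (simp add: less_eq_tern_def)
    ultimately have "y \<notin> S k b" if "b \<noteq> a" for b
      using le_funD[OF le(1), of k] that by (auto simp: code_le_iff[OF S y])
    moreover obtain b where "b \<noteq> a" by (metis zero_neq_one)
    ultimately show ?thesis using closure_of_dyadic[OF S, of a b k] a y by (simp add: cell_def)
  qed
  then show ?thesis using y by (simp add: closed_cell_Inter_def)
qed

lemma cell_Inter_neighbourhood: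
  assumes S: "dyadic_subbase X S" and U: "openin X U" "x \<in> U"
  shows "\<exists>m. cell_Inter X S (trunc (code X S x) m) \<subseteq> U"
proof -
  have x: "x \<in> topspace X" using U openin_subset by blast
  have "X = topology (arbitrary union_of
           (finite intersection_of (\<lambda>U. \<exists>n a. U = S n a) relative_to topspace X))"
    using S unfolding dyadic_subbase_def by blast
  then have "openin X U = openin (topology (arbitrary union_of
           (finite intersection_of (\<lambda>U. \<exists>n a. U = S n a) relative_to topspace X))) U"
    by (rule arg_cong[where f = "\<lambda>T. openin T U"])
  then have "(arbitrary union_of
      (finite intersection_of (\<lambda>U. \<exists>n a. U = S n a) relative_to topspace X)) U"
    using U(1) by (simp add: openin_subbase)
  then obtain W where W: "(finite intersection_of (\<lambda>U. \<exists>n a. U = S n a) relative_to topspace X) W"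
    "x \<in> W" "W \<subseteq> U"
    using U(2) unfolding arbitrary_union_of_alt by blast
  then obtain \<V> where \<V>: "finite \<V>" "\<V> \<subseteq> {U. \<exists>n a. U = S n a}" "W = topspace X \<inter> \<Inter>\<V>"
    by (auto simp: relative_to_def intersection_of_def)
  have "\<exists>n. \<forall>y\<in>topspace X. code X S x n \<le> code X S y n \<longrightarrow> y \<in> V" if V: "V \<in> \<V>" for V
  proof -
    obtain n a where na: "V = S n a" using V \<V>(2) by blast
    then have "code X S x n = Digit a"
      using V W(2) \<V>(3) x code_eq_Digit_iff[OF S] by blast
    then show ?thesis
      using na code_eq_Digit_iff[OF S] by (metis less_eq_tern_def tern.distinct(1))
  qed
  then obtain n where n: "\<And>V y. V \<in> \<V> \<Longrightarrow> y \<in> topspace X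
      \<Longrightarrow> code X S x (n V) \<le> code X S y (n V) \<Longrightarrow> y \<in> V"
    by metis
  obtain m where m: "\<forall>V\<in>\<V>. n V < m"
    using \<V>(1) finite_nat_set_iff_bounded[of "n ` \<V>"] by auto
  have "cell_Inter X S (trunc (code X S x) m) \<subseteq> W"
    using n m \<V>(3) by (auto simp: mem_cell_Inter_iff[OF S] trunc_le_iff)
  then show ?thesis using W(3) by blast
qed

text \<open>This is where properness enters: the closed cells of \<open>e\<close> intersect in the closure of the
  intersection of its open cells, which regularity makes small.\<close>

lemma closed_cell_Inter_neighbourhood:
  assumes S: "proper_dyadic_subbase X S" and reg: "regular_space X" and U: "openin X U" "x \<in> U"
  shows "\<exists>m. closed_cell_Inter X S (trunc (code X S x) m) \<subseteq> U"
proof -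
  have S': "dyadic_subbase X S" using S by (simp add: proper_dyadic_subbase_def)
  have "neighbourhood_base_of (closedin X) X" using reg by (simp add: neighbourhood_base_of_closedin)
  then have "\<exists>V C. openin X V \<and> closedin X C \<and> x \<in> V \<and> V \<subseteq> C \<and> C \<subseteq> U"
    using U by (simp add: neighbourhood_base_of)
  then obtain V C where V: "openin X V" "closedin X C" "x \<in> V" "V \<subseteq> C" "C \<subseteq> U"
    by metis
  obtain m where m: "cell_Inter X S (trunc (code X S x) m) \<subseteq> V"
    using cell_Inter_neighbourhood[OF S' V(1,3)] by blast
  have "closed_cell_Inter X S (trunc (code X S x) m)
      = X closure_of cell_Inter X S (trunc (code X S x) m)"
    using S trunc_tfin by (simp add: proper_dyadic_subbase_def)
  also have "\<dots> \<subseteq> C" using closure_of_minimal m V by (metis order_trans)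
  finally show ?thesis using V(5) by blast
qed

lemma infinite_tdom_code:
  assumes S: "dyadic_subbase X S" and t1: "t1_space X" and x: "x \<in> topspace X"
  shows "infinite (tdom (code X S x))"
proof
  assume fin: "finite (tdom (code X S x))"
  have "y = x" if y: "y \<in> cell_Inter X S (code X S x)" for y
  proof (rule ccontr)
    assume "y \<noteq> x"
    have yX: "y \<in> topspace X" "code X S x \<le> code X S y"
      using y mem_cell_Inter_iff[OF S] by auto
    have "openin X (topspace X - {y})"
      using t1 yX by (simp add: t1_space_closedin_singleton openin_diff)
    then obtain m where "cell_Inter X S (trunc (code X S x) m) \<subseteq> topspace X - {y}"
      using cell_Inter_neighbourhood[OF S, of "topspace X - {y}" x] x \<open>y \<noteq> x\<close> by blast
    moreover have "y \<in> cell_Inter X S (trunc (code X S x) m)"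
      using yX trunc_le order_trans unfolding mem_cell_Inter_iff[OF S] by blast
    ultimately show False by blast
  qed
  then have "cell_Inter X S (code X S x) = {x}"
    using x mem_cell_Inter_iff[OF S, of x] by auto
  then have iso: "openin X {x}"
    using openin_cell_Inter[OF S, of "code X S x"] fin by (simp add: tfin_def)
  obtain n where "n \<notin> tdom (code X S x)" using fin ex_new_if_finite infinite_UNIV_nat by blast
  then have n: "x \<notin> S n a" for a
    using code_eq_Digit_iff[OF S x, of n a] by (auto simp: tdom_def)
  then have "x \<in> X closure_of S n 0"
    using closure_of_dyadic[OF S, of 0 1] x by simp
  \<comment> \<open>an isolated point in a closure belongs to the set itself\<close>
  then have "x \<in> S n 0" using iso by (auto simp: in_closure_of)
  then show False using n by blast
qed

section \<open>The code below a limit element\<close>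

lemma code_below_unique:
  assumes S: "proper_dyadic_subbase X S" and reg: "regular_space X" and t1: "t1_space X"
    and x: "x \<in> topspace X" "code X S x \<le> p" and y: "y \<in> topspace X" "code X S y \<le> p"
  shows "x = y"
proof (rule ccontr)
  assume "x \<noteq> y"
  moreover have "openin X (topspace X - {y})"
    using t1 y(1) by (simp add: t1_space_closedin_singleton openin_diff)
  ultimately obtain m where "closed_cell_Inter X S (trunc (code X S x) m) \<subseteq> topspace X - {y}"
    using closed_cell_Inter_neighbourhood[OF S reg, of "topspace X - {y}" x] x by blast
  moreover have "y \<in> closed_cell_Inter X S (trunc (code X S x) m)"
    using S mem_closed_cell_Inter[OF _ y order_trans[OF trunc_le x(2)]]
    by (simp add: proper_dyadic_subbase_def)
  ultimately show False by blast
qed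

lemma code_below_limit_exists:
  assumes S: "dyadic_subbase X S" and comp: "compact_space X" and P: "P \<subseteq> up_codes X S"
    and p: "p \<in> limit_elements (sup_ideals (truncations P))"
  shows "\<exists>x\<in>topspace X. code X S x \<le> p"
proof -
  define C where "C m = {x \<in> topspace X. trunc (code X S x) m \<le> p}" for m
  have C_alt: "C m = topspace X \<inter> (\<Inter>k\<in>{..<m}. {x \<in> topspace X. code X S x k \<le> p k})" for m
    by (auto simp: C_def trunc_le_iff)
  have clo: "closedin X (C m)" for m
  proof (cases m)
    case (Suc l)
    then show ?thesis
      unfolding C_alt by (intro closedin_Int closedin_topspace closedin_INT closedin_code_le[OF S]) auto
  qed (simp add: C_alt)
  have ne: "C m \<noteq> {}" for m
  proof -
    have "infinite (tdom p)" and pE: "p \<in> sup_ideals (truncations P)"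
      using p by (auto simp: limit_elements_truncations)
    then obtain n where n: "n \<ge> m" "p n \<noteq> \<bottom>\<^sub>T"
      by (auto simp: infinite_nat_iff_unbounded_le tdom_def)
    obtain q l where q: "q \<in> P" "trunc p (Suc n) = trunc q l"
      using pE truncations_def[of P] unfolding sup_ideals_truncations by blast
    \<comment> \<open>the digit at place \<open>n\<close> forces the truncation of \<open>q\<close> to have length greater than \<open>n\<close>\<close>
    have "trunc q l n = p n" using q(2) by (metis lessI trunc_def)
    then have "n < l" using n(2) by (auto simp: trunc_def split: if_splits)
    obtain x where x: "x \<in> topspace X" "code X S x \<le> q" using q(1) P by (auto simp: up_codes_def)
    have "trunc (code X S x) m \<le> trunc q m" using x(2) by (rule trunc_mono)
    also have "\<dots> \<le> trunc q l" using \<open>n < l\<close> n(1) by (intro trunc_mono_length) simp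
    also have "\<dots> \<le> p" unfolding q(2)[symmetric] by (rule trunc_le)
    finally show ?thesis using x(1) by (auto simp: C_def)
  qed
  have "decseq C" by (auto simp: decseq_def C_def trunc_le_iff)
  then obtain x where "x \<in> (\<Inter>m. C m)"
    using compact_space_imp_nest[of X C] comp clo ne by blast
  then have "x \<in> topspace X" "\<forall>m. trunc (code X S x) m \<le> p" by (auto simp: C_def)
  then show ?thesis using le_iff_trunc_le by blast
qed

text \<open>The retraction onto the space; the value is arbitrary when no code lies below \<open>p\<close>.\<close>

definition decode :: "'a topology \<Rightarrow> (nat \<Rightarrow> bit \<Rightarrow> 'a set) \<Rightarrow> tseq \<Rightarrow> 'a" where
  "decode X S p = (SOME x. x \<in> topspace X \<and> code X S x \<le> p)"

text \<open>The bounds on \<open>P\<close> make codes elements of the completion and let every truncation dominate a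
  truncation of a code; nothing else about \<open>P\<close> matters, so both completions are covered.\<close>

lemma minimal_and_retract:
  fixes X :: "'a topology"
  assumes comp: "compact_space X" and haus: "Hausdorff_space X"
    and S: "proper_dyadic_subbase X S"
    and P: "codes X S \<subseteq> P" "P \<subseteq> up_codes X S"
    and E: "E = sup_ideals (truncations P)"
  shows "codes X S = minimal_elements (limit_elements E)"
    and "embedding_map X (limit_space E) (code X S)"
    and "codes X S retract_of_space limit_space E"
proof -
  have S': "dyadic_subbase X S" using S by (simp add: proper_dyadic_subbase_def)
  have reg: "regular_space X" by (rule compact_Hausdorff_imp_regular_space[OF comp haus])
  have t1: "t1_space X" by (rule Hausdorff_imp_t1_space[OF haus])
  have top: "topspace (limit_space E) = limit_elements E"
    by (auto simp: limit_space_def limit_elements_def)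
  have code_limit: "code X S x \<in> limit_elements E" if "x \<in> topspace X" for x
    using that P(1) infinite_tdom_code[OF S' t1 that]
    unfolding E limit_elements_truncations by (auto simp: sup_ideals_truncations codes_def intro: truncationsI)
  have decode: "decode X S p \<in> topspace X" "code X S (decode X S p) \<le> p"
    if "p \<in> limit_elements E" for p
    using someI_ex[OF code_below_limit_exists[OF S' comp P(2) that[unfolded E], unfolded Bex_def]]
    by (auto simp: decode_def)
  have unique: "x = y" if "x \<in> topspace X" "code X S x \<le> p" "y \<in> topspace X" "code X S y \<le> p" for x y p
    using code_below_unique[OF S reg t1 that] .
  show "codes X S = minimal_elements (limit_elements E)"
  proof (intro set_eqI iffI)
    fix p assume "p \<in> codes X S"
    then obtain x where x: "x \<in> topspace X" "p = code X S x" by (auto simp: codes_def)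
    have "q = p" if q: "q \<in> limit_elements E" "q \<le> p" for q
    proof -
      have "decode X S q = x"
        using unique[of "decode X S q" p x] decode[OF q(1)] q(2) x order_trans by auto
      then show ?thesis using decode(2)[OF q(1)] q(2) x(2) by auto
    qed
    then show "p \<in> minimal_elements (limit_elements E)"
      using code_limit x by (simp add: minimal_elements_def)
  next
    fix p assume "p \<in> minimal_elements (limit_elements E)"
    then have p: "p \<in> limit_elements E" "\<And>q. q \<in> limit_elements E \<Longrightarrow> q \<le> p \<Longrightarrow> q = p"
      by (auto simp: minimal_elements_def)
    have "code X S (decode X S p) = p"
      using p decode[OF p(1)] code_limit by blast
    then show "p \<in> codes X S" using decode(1)[OF p(1)] by (metis codes_def imageI)
  qed
  have cont_code: "continuous_map X (limit_space E) (code X S)"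
    unfolding continuous_map_eq_topcontinuous_at topcontinuous_at_def
  proof (intro ballI conjI allI impI)
    show "code X S \<in> topspace X \<rightarrow> topspace (limit_space E)" using code_limit top by auto
    fix x V assume x: "x \<in> topspace X" and V: "openin (limit_space E) V \<and> code X S x \<in> V"
    then obtain U where U: "scott_open E U" "V = U \<inter> limit_elements E"
      by (auto simp: limit_space_def openin_subtopology openin_scott_topology)
    then obtain m where m: "trunc (code X S x) m \<in> U"
      using scott_open_contains_trunc V unfolding E by blast
    let ?W = "cell_Inter X S (trunc (code X S x) m)"
    have "code X S y \<in> V" if "y \<in> ?W" for y
    proof -
      have y: "y \<in> topspace X" "trunc (code X S x) m \<le> code X S y"
        using that mem_cell_Inter_iff[OF S'] by auto
      then have "code X S y \<in> limit_elements E" using code_limit by blast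
      then show ?thesis
        using scott_openD(2)[OF U(1) m _ y(2)] U(2) by (simp add: limit_elements_def)
    qed
    moreover have "x \<in> ?W" using x trunc_le mem_cell_Inter_iff[OF S'] by blast
    ultimately show "\<exists>U. openin X U \<and> x \<in> U \<and> (\<forall>y\<in>U. code X S y \<in> V)"
      using openin_cell_Inter[OF S' trunc_tfin] by blast
  qed
  have cont_decode: "continuous_map (limit_space E) X (decode X S)"
    unfolding continuous_map_eq_topcontinuous_at topcontinuous_at_def
  proof (intro ballI conjI allI impI)
    show "decode X S \<in> topspace (limit_space E) \<rightarrow> topspace X" using decode top by auto
    fix p V assume p: "p \<in> topspace (limit_space E)" and V: "openin X V \<and> decode X S p \<in> V"
    let ?x = "decode X S p"
    obtain m where m: "closed_cell_Inter X S (trunc (code X S ?x) m) \<subseteq> V"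
      using closed_cell_Inter_neighbourhood[OF S reg] V by blast
    let ?e = "trunc (code X S ?x) m"
    \<comment> \<open>points with code below an element of \<open>?W\<close> lie in the closed cells of \<open>?e\<close>\<close>
    let ?W = "{q \<in> E. ?e \<le> q} \<inter> limit_elements E"
    have "openin (limit_space E) ?W"
      using scott_open_above_finite[OF trunc_tfin]
      unfolding E limit_space_def openin_subtopology openin_scott_topology by blast
    moreover have "p \<in> ?W"
      using p top decode(2)[of p] order_trans[OF trunc_le] by (auto simp: limit_elements_def)
    moreover have "decode X S q \<in> V" if "q \<in> ?W" for q
      using mem_closed_cell_Inter[OF S' decode(1) decode(2)] that m by blast
    ultimately show "\<exists>U. openin (limit_space E) U \<and> p \<in> U \<and> (\<forall>q\<in>U. decode X S q \<in> V)" by blast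
  qed
  have inv: "decode X S (code X S x) = x" if "x \<in> topspace X" for x
    using unique decode code_limit that by blast
  then have "retraction_maps (limit_space E) X (decode X S) (code X S)"
    using cont_code cont_decode by (simp add: retraction_maps_def)
  then show "embedding_map X (limit_space E) (code X S)"
    by (intro section_imp_embedding_map) (auto simp: section_map_def)
  show "codes X S retract_of_space limit_space E"
    unfolding retract_of_space_def
  proof (intro conjI exI)
    show "codes X S \<subseteq> topspace (limit_space E)" using code_limit top by (auto simp: codes_def)
    show "continuous_map (limit_space E) (subtopology (limit_space E) (codes X S)) (code X S \<circ> decode X S)"
      using continuous_map_compose[OF cont_decode cont_code] decode top
      by (auto simp: continuous_map_in_subtopology codes_def)
    show "\<forall>p\<in>codes X S. (code X S \<circ> decode X S) p = p" using inv by (auto simp: codes_def)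
  qed
qed

theorem theorem6p4:
  fixes X :: "'a topology" and S :: "nat \<Rightarrow> bit \<Rightarrow> 'a set" and E :: "tseq set"
  assumes "topspace X \<noteq> {}"
    and "second_countable X" and "compact_space X" and "Hausdorff_space X"
    and "proper_dyadic_subbase X S"
    and "E = dyadic_D X S \<or> E = dyadic_D_hat X S"
  shows "codes X S = minimal_elements (limit_elements E)
    \<and> embedding_map X (limit_space E) (code X S)
    \<and> codes X S retract_of_space limit_space E"
proof -
  have "codes X S \<subseteq> up_codes X S" by (auto simp: codes_def up_codes_def)
  moreover have "E = sup_ideals (truncations (codes X S)) \<or> E = sup_ideals (truncations (up_codes X S))"
    using assms(6) by (simp add: dyadic_D_def dyadic_D_hat_def dyadic_K_def dyadic_K_hat_def truncations_def)
  ultimately obtain P where "codes X S \<subseteq> P" "P \<subseteq> up_codes X S" "E = sup_ideals (truncations P)"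
    by blast
  then show ?thesis by (intro conjI minimal_and_retract[OF assms(3,4,5)])
qed

end
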